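(* Let $k\ge 1$ be an integer, let $G$ be a connected triangle-free graph on $n$ vertices, and let $v\in V(G)$. If $G$ contains no induced subgraph on $k+1$ vertices that is a tree containing $v$, then $n\le 1+\frac{(k-1)k}{2}$. Further, equality $n=1+\frac{(k-1)k}{2}$ holds only if $G$ is isomorphic to $G_k$ via an isomorphism mapping $v$ to $v_0$.
   Context: All graphs are simple and finite. For $k\ge 1$, $G_k$ is the bipartite graph obtained from the path $P^k=v_0v_1\ldots v_{k-1}$ by replacing, for each $1\le i\le k-1$, the vertex $v_i$ by $k-i$ independent vertices (each copy of $v_i$ being adjacent to every copy of $v_{i-1}$ and of $v_{i+1}$), while $v_0$ remains a single vertex. Thus $|G_k|=1+\frac{(k-1)k}{2}$. *)

theory Defs
  imports Main
begin

definition simple_graph :: "'a set \<Rightarrow> ('a \<Rightarrow> 'a \<Rightarrow> bool) \<Rightarrow> bool" where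
  "simple_graph V E \<longleftrightarrow> finite V \<and> (\<forall>x y. E x y \<longrightarrow> x \<in> V \<and> y \<in> V)
     \<and> (\<forall>x y. E x y \<longrightarrow> E y x) \<and> (\<forall>x. \<not> E x x)"

definition connected_on :: "'a set \<Rightarrow> ('a \<Rightarrow> 'a \<Rightarrow> bool) \<Rightarrow> bool" where
  "connected_on S E \<longleftrightarrow> (\<forall>x\<in>S. \<forall>y\<in>S. (\<lambda>a b. a \<in> S \<and> b \<in> S \<and> E a b)\<^sup>*\<^sup>* x y)"

definition triangle_free :: "'a set \<Rightarrow> ('a \<Rightarrow> 'a \<Rightarrow> bool) \<Rightarrow> bool" where
  "triangle_free V E \<longleftrightarrow> \<not> (\<exists>x\<in>V. \<exists>y\<in>V. \<exists>z\<in>V. E x y \<and> E y z \<and> E x z)"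

definition has_cycle_on :: "'a set \<Rightarrow> ('a \<Rightarrow> 'a \<Rightarrow> bool) \<Rightarrow> bool" where
  "has_cycle_on S E \<longleftrightarrow> (\<exists>xs. length xs \<ge> 3 \<and> distinct xs \<and> set xs \<subseteq> S
      \<and> (\<forall>i. Suc i < length xs \<longrightarrow> E (xs ! i) (xs ! Suc i)) \<and> E (last xs) (hd xs))"

definition induced_tree :: "'a set \<Rightarrow> ('a \<Rightarrow> 'a \<Rightarrow> bool) \<Rightarrow> bool" where
  "induced_tree S E \<longleftrightarrow> S \<noteq> {} \<and> connected_on S E \<and> \<not> has_cycle_on S E"

text \<open>The graph G_k: vertex (0,0) is v_0; vertices (i,j) with 1 \<le> i \<le> k-1, j < k-i are
  the k-i copies of v_i. Copies of v_i and v_{i'} are adjacent iff |i - i'| = 1.\<close>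
definition Gk_V :: "nat \<Rightarrow> (nat \<times> nat) set" where
  "Gk_V k = {(0,0)} \<union> {(i,j). 1 \<le> i \<and> i \<le> k - 1 \<and> j < k - i}"

definition Gk_E :: "nat \<Rightarrow> nat \<times> nat \<Rightarrow> nat \<times> nat \<Rightarrow> bool" where
  "Gk_E k p q \<longleftrightarrow> p \<in> Gk_V k \<and> q \<in> Gk_V k \<and> (fst q = fst p + 1 \<or> fst p = fst q + 1)"

definition graph_iso :: "'a set \<Rightarrow> ('a \<Rightarrow> 'a \<Rightarrow> bool) \<Rightarrow> 'b set \<Rightarrow> ('b \<Rightarrow> 'b \<Rightarrow> bool) \<Rightarrow> ('a \<Rightarrow> 'b) \<Rightarrow> bool" where
  "graph_iso V E W F f \<longleftrightarrow> bij_betw f V W \<and> (\<forall>x\<in>V. \<forall>y\<in>V. E x y \<longleftrightarrow> F (f x) (f y))"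

end

theory Submission
  imports Defs
begin

text \<open>Induction on the number of vertices. The neighbourhood N of v is independent, so a star
  at v shows |N| \<le> k - 1. Let C range over the components of G - v - N. If w \<in> N has a neighbour
  in C, then by induction C + w contains an induced tree through w with a(C) + 1 vertices, where
  2|C| \<le> a(C)(a(C) + 1). For U \<subseteq> N, the vertex v, the set U and the trees of all components
  touched by exactly one vertex of U form an induced tree on 1 + M vertices, with M the sum of |U|
  and the corresponding a(C). A purely combinatorial lemma on weighted set systems provides U with
  M(M - 1) \<ge> \<Sum>a(C)(a(C) + 1), strictly if there are two components. As M \<le> k - 1, the sum of
  all |C| is at most (k - 1)(k - 2)/2. In case of equality there is at most one component C, each
  C + w is a copy of the extremal graph for k - 1, and all w \<in> N have the same neighbours in C,
  since otherwise there is a tree on k + 1 vertices.\<close>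

section \<open>Quadratic inequalities over the naturals\<close>

text \<open>Each \<open>a C\<close> is at most the total; multiply by \<open>a C\<close> and sum. A
  second positive weight makes \<open>a C\<close> strictly smaller than the total.\<close>

lemma sum_squares_le_square_sum:
  fixes a :: "'c \<Rightarrow> nat"
  assumes "finite A"
  shows "(\<Sum>C\<in>A. a C * a C) \<le> (\<Sum>C\<in>A. a C) * (\<Sum>C\<in>A. a C)"
    and "\<lbrakk>C \<in> A; D \<in> A; C \<noteq> D; a C > 0; a D > 0\<rbrakk>
      \<Longrightarrow> (\<Sum>C\<in>A. a C * a C) < (\<Sum>C\<in>A. a C) * (\<Sum>C\<in>A. a C)"
proof -
  have le: "a C \<le> sum a A" if "C \<in> A" for C
    using member_le_sum[of C A a] that assms by simp
  show "(\<Sum>C\<in>A. a C * a C) \<le> sum a A * sum a A"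
    unfolding sum_distrib_right by (intro sum_mono mult_le_mono) (auto intro: le)
  assume *: "C \<in> A" "D \<in> A" "C \<noteq> D" "a C > 0" "a D > 0"
  have "sum a {C, D} \<le> sum a A"
    using * assms by (intro sum_mono2) auto
  then have "a C < sum a A" using * by simp
  then have "a C * a C < a C * sum a A" using * by simp
  then show "(\<Sum>C\<in>A. a C * a C) < sum a A * sum a A"
    unfolding sum_distrib_right
    using assms * by (intro sum_strict_mono_ex1) (auto intro!: le)
qed

text \<open>x(x - 1) increases for positive x, and the hypothesis excludes x = 0. The additive form
  avoids truncated subtraction.\<close>

lemma quadratic_less_mono:
  fixes x y n :: nat
  assumes "x \<le> y" "n + x < x * x"
  shows "n + y < y * y"
proof -
  obtain d where d: "y = x + d" using assms(1) le_Suc_ex by blast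
  have "x > 0" using assms(2) by (cases x) auto
  then have "d * 1 \<le> d * x" by (intro mult_le_mono) auto
  then show ?thesis using assms(2) unfolding d distrib_left distrib_right
    by (simp only: mult.commute)
qed

lemma quadratic_le_mono:
  fixes x y n :: nat
  assumes "x \<le> y" "n + x \<le> x * x"
  shows "n + y \<le> y * y"
proof (cases n)
  case (Suc m)
  then show ?thesis using quadratic_less_mono[of x y m] assms by simp
qed simp

section \<open>Minimal covers and weighted set systems\<close>

text \<open>In a cover of least cardinality, deleting \<open>w\<close> uncovers some member of
  \<open>P\<close>; this member is private to \<open>w\<close> and serves as
  \<open>c w\<close>.\<close>

lemma minimal_cover:
  assumes "finite W" and "\<forall>C\<in>P. \<exists>w\<in>W. R w C"
  obtains X c where "X \<subseteq> W" "\<forall>C\<in>P. \<exists>w\<in>X. R w C"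
    "\<And>w. w \<in> X \<Longrightarrow> c w \<in> P \<and> R w (c w)"
    "\<And>w u. \<lbrakk>w \<in> X; u \<in> X; R u (c w)\<rbrakk> \<Longrightarrow> u = w"
proof -
  define Q where "Q X \<longleftrightarrow> X \<subseteq> W \<and> (\<forall>C\<in>P. \<exists>w\<in>X. R w C)" for X
  have "Q W" using assms by (auto simp: Q_def)
  then obtain X where X: "Q X" and min: "\<And>Y. Q Y \<Longrightarrow> card X \<le> card Y"
    using ex_has_least_nat[of Q W card] by blast
  have fin: "finite X" using X assms(1) finite_subset by (auto simp: Q_def)
  have "\<exists>C\<in>P. R w C \<and> (\<forall>u\<in>X. R u C \<longrightarrow> u = w)" if w: "w \<in> X" for w
  proof -
    have "\<not> Q (X - {w})"
      using min[of "X - {w}"] card_Diff1_less[OF fin w] by auto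
    then obtain C where C: "C \<in> P" "\<not> (\<exists>u\<in>X - {w}. R u C)"
      using X by (auto simp: Q_def)
    with X show ?thesis by (intro bexI[of _ C]) (auto simp: Q_def)
  qed
  then obtain c where "\<forall>w\<in>X. c w \<in> P \<and> R w (c w) \<and> (\<forall>u\<in>X. R u (c w) \<longrightarrow> u = w)"
    by metis
  with X show ?thesis by (intro that[of X c]) (auto simp: Q_def)
qed

text \<open>With the components as \<open>CC\<close>, these are the ones whose trees can be hung on
  a single vertex of \<open>U\<close>; contact with two vertices of \<open>U\<close> could close a
  cycle through the root.\<close>

definition uniquely_hit :: "('a \<Rightarrow> 'c \<Rightarrow> bool) \<Rightarrow> 'c set \<Rightarrow> 'a set \<Rightarrow> 'c set" where
  "uniquely_hit R CC U = {C \<in> CC. \<exists>!w. w \<in> U \<and> R w C}"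

text \<open>In a minimal cover every element has a private set. Lowering the weight of one private
  set for each element by one and recursing either gains one unit back on the recursive choice,
  or shows that the minimal cover itself is good enough.\<close>

lemma heavy_uniquely_hit:
  fixes a :: "'c \<Rightarrow> nat" and R :: "'a \<Rightarrow> 'c \<Rightarrow> bool"
  assumes "finite CC" "finite W" "W \<noteq> {}" "\<forall>C\<in>CC. a C > 0 \<longrightarrow> (\<exists>w\<in>W. R w C)"
  shows "\<exists>U M. U \<subseteq> W \<and> U \<noteq> {} \<and> M = card U + sum a (uniquely_hit R CC U)
    \<and> (\<Sum>C\<in>CC. a C * (a C + 1)) + M \<le> M * M
    \<and> ((\<exists>C\<in>CC. \<exists>D\<in>CC. C \<noteq> D \<and> a C > 0 \<and> a D > 0) \<longrightarrow>
        (\<Sum>C\<in>CC. a C * (a C + 1)) + M < M * M)"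
  using assms
proof (induction "sum a CC" arbitrary: a W rule: less_induct)
  case less
  note finCC = less.prems(1)
  define P where "P = {C\<in>CC. a C > 0}"
  have "\<forall>C\<in>P. \<exists>w\<in>W. R w C" using less.prems(4) by (auto simp: P_def)
  from minimal_cover[OF less.prems(2) this] obtain X c where X: "X \<subseteq> W"
    and cov: "\<forall>C\<in>P. \<exists>w\<in>X. R w C"
    and c: "\<And>w. w \<in> X \<Longrightarrow> c w \<in> P \<and> R w (c w)"
    and uniq: "\<And>w u. \<lbrakk>w \<in> X; u \<in> X; R u (c w)\<rbrakk> \<Longrightarrow> u = w"
    by metis
  have finX: "finite X" using X less.prems(2) finite_subset by blast
  have finU: "finite (uniquely_hit R CC U)" for U
    using finCC by (auto simp: uniquely_hit_def)
  have inj: "inj_on c X" using c uniq by (metis inj_onI)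
  have cCC: "c ` X \<subseteq> CC" using c by (auto simp: P_def)
  have private_hit: "c w \<in> uniquely_hit R CC U" if "w \<in> U" "U \<subseteq> X" for w U
  proof -
    have "w \<in> X" using that by blast
    moreover have "u = w" if "u \<in> U" "R u (c w)" for u
      using uniq[of w u] that \<open>w \<in> X\<close> \<open>U \<subseteq> X\<close> by blast
    ultimately show ?thesis using that(1) cCC c[of w] by (auto simp: uniquely_hit_def)
  qed
  define n where "n = (\<Sum>C\<in>CC. a C * (a C + 1))"
  consider "X = {}" | w where "X = {w}" | "card X \<ge> 2"
    using finX by (metis One_nat_def card_0_eq card_1_singletonE less_2_cases not_le)
  then show ?case
  proof cases
    case 1
    then have z: "a C = 0" if "C \<in> CC" for C using cov that by (auto simp: P_def)
    obtain w where "w \<in> W" using less.prems(3) by blast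
    then show ?thesis
      using z by (intro exI[of _ "{w}"] exI[of _ "card {w} + sum a (uniquely_hit R CC {w})"]) auto
  next
    case (2 w)
    have "sum a (uniquely_hit R CC {w}) = sum a CC"
      using finCC cov 2 by (intro sum.mono_neutral_left) (auto simp: uniquely_hit_def P_def)
    then have M: "Suc (sum a CC) = card {w} + sum a (uniquely_hit R CC {w})" by simp
    \<comment> \<open>With s = \<open>sum a CC\<close> and \<open>M\<close> = s + 1, this reduces
      \<open>n + M \<le> M * M\<close> to comparing the sum of squares with s * s.\<close>
    have n: "n + Suc (sum a CC) + sum a CC * sum a CC
        = (\<Sum>C\<in>CC. a C * a C) + Suc (sum a CC) * Suc (sum a CC)"
      by (simp add: n_def sum.distrib algebra_simps)
    show ?thesis unfolding n_def[symmetric]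
      apply (rule exI[of _ "{w}"], rule exI[of _ "Suc (sum a CC)"])
      using X 2 M n sum_squares_le_square_sum(1)[OF finCC, of a]
        sum_squares_le_square_sum(2)[OF finCC, of _ _ a] by fastforce
  next
    case 3
    define a' where "a' C = (if C \<in> c ` X then a C - 1 else a C)" for C
    define p where "p = (\<Sum>w\<in>X. a (c w))"
    define n' where "n' = (\<Sum>C\<in>CC. a' C * (a' C + 1))"
    have le: "a' C \<le> a C" for C by (simp add: a'_def)
    have a'_Suc: "a (c w) = Suc (a' (c w))" if "w \<in> X" for w
      using c[OF that] that by (auto simp: a'_def P_def)
    obtain w where "w \<in> X" using 3 by fastforce
    then have "sum a' CC < sum a CC"
      using finCC cCC a'_Suc le by (intro sum_strict_mono_ex1) (auto intro!: bexI[of _ "c w"])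
    moreover have "\<forall>C\<in>CC. a' C > 0 \<longrightarrow> (\<exists>w\<in>X. R w C)"
      using cov le by (metis (mono_tags, lifting) P_def less_le_trans mem_Collect_eq)
    \<comment> \<open>The recursion runs on \<open>X\<close> instead of \<open>W\<close>, so that
      the private set of each member of \<open>U\<close> is uniquely hit by
      \<open>U\<close>.\<close>
    ultimately obtain U M' where U: "U \<subseteq> X" "U \<noteq> {}"
      and M': "M' = card U + sum a' (uniquely_hit R CC U)" "n' + M' \<le> M' * M'"
      using less.hyps[of a' X] finX finCC \<open>w \<in> X\<close> unfolding n'_def by blast
    \<comment> \<open>Lowering a weight from a to a - 1 lowers a(a + 1) by 2a, so the total drops by
      2p.\<close>
    have "n = (\<Sum>C\<in>CC. a' C * (a' C + 1) + (if C \<in> c ` X then 2 * a C else 0))"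
      unfolding n_def
    proof (rule sum.cong[OF refl])
      fix C show "a C * (a C + 1) = a' C * (a' C + 1) + (if C \<in> c ` X then 2 * a C else 0)"
      proof (cases "C \<in> c ` X")
        case True
        then have "a C = Suc (a' C)" using a'_Suc by blast
        with True show ?thesis by simp
      qed (simp add: a'_def)
    qed
    also have "\<dots> = n' + (\<Sum>C\<in>c ` X. 2 * a C)"
      unfolding sum.distrib n'_def using finCC cCC
      by (simp add: sum.inter_restrict[symmetric] Int_absorb1)
    also have "\<dots> = n' + 2 * p"
      using inj by (simp add: p_def sum.reindex sum_distrib_left)
    finally have n: "n = n' + 2 * p" .
    obtain V where V: "V \<subseteq> X" "V \<noteq> {}"
      "n + (card V + sum a (uniquely_hit R CC V))
        < (card V + sum a (uniquely_hit R CC V)) * (card V + sum a (uniquely_hit R CC V))"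
    proof (cases "M' \<le> p")
      \<comment> \<open>All of \<open>X\<close> is chosen: the private sets alone give weight
        \<open>p\<close>, and \<open>card X\<close> adds at least 2. Here n \<le> p(p - 1) + 2p =
        p(p + 1) < (p + 2)(p + 1).\<close>
      case True
      have "p = sum a (c ` X)" using inj by (simp add: p_def sum.reindex)
      also have "\<dots> \<le> sum a (uniquely_hit R CC X)"
        using finU private_hit by (intro sum_mono2) auto
      finally have "p + 2 \<le> card X + sum a (uniquely_hit R CC X)" using 3 by simp
      moreover have "n + (p + 2) < (p + 2) * (p + 2)"
      proof -
        obtain d where d: "p = M' + d" using True le_Suc_ex by blast
        show ?thesis using M'(2) n unfolding d by (simp add: algebra_simps)
      qed
      ultimately show ?thesis using that[of X] quadratic_less_mono \<open>w \<in> X\<close> by blast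
    next
      \<comment> \<open>Restoring the weights gains at least one, from the private set of
        \<open>u\<close>, so the total reaches M' + 1. As p < M', n < M'(M' - 1) + 2M' = (M' +
        1)M'.\<close>
      case False
      obtain u where u: "u \<in> U" using U by blast
      have "sum a' (uniquely_hit R CC U) < sum a (uniquely_hit R CC U)"
        using finU le private_hit[OF u U(1)] a'_Suc[of u] u U(1)
        by (intro sum_strict_mono_ex1) (auto intro!: bexI[of _ "c u"])
      then have "Suc M' \<le> card U + sum a (uniquely_hit R CC U)" using M'(1) by simp
      moreover have "n + Suc M' < Suc M' * Suc M'" using M'(2) n False by simp
      ultimately show ?thesis using that[of U] quadratic_less_mono U by blast
    qed
    then show ?thesis using X unfolding n_def[symmetric] by (meson less_imp_le order_trans)
  qed
qed

section \<open>Induced trees grown by pendant vertices\<close>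

text \<open>Induced trees through the root r, built so that truncation to a smaller size needs no
  argument about leaves.\<close>

inductive grown_tree :: "('a \<Rightarrow> 'a \<Rightarrow> bool) \<Rightarrow> 'a \<Rightarrow> 'a set \<Rightarrow> bool" for E r where
  root: "grown_tree E r {r}"
| pendant: "\<lbrakk>grown_tree E r T; x \<notin> T; \<exists>!y. y \<in> T \<and> E x y\<rbrakk> \<Longrightarrow> grown_tree E r (insert x T)"

lemma grown_tree_root_mem: "grown_tree E r T \<Longrightarrow> r \<in> T"
  by (induction rule: grown_tree.induct) auto

lemma grown_tree_finite: "grown_tree E r T \<Longrightarrow> finite T"
  by (induction rule: grown_tree.induct) auto

text \<open>Growth adds one vertex at a time, so stopping it early yields every smaller
  size.\<close>

lemma grown_tree_truncate:
  assumes "grown_tree E r T" "1 \<le> m" "m \<le> card T"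
  shows "\<exists>T'. grown_tree E r T' \<and> T' \<subseteq> T \<and> card T' = m"
  using assms
proof (induction rule: grown_tree.induct)
  case root
  then show ?case by (auto intro: grown_tree.root)
next
  case (pendant T x)
  show ?case
  proof (cases "m \<le> card T")
    case True
    then show ?thesis using pendant by blast
  next
    case False
    then have "card (insert x T) = m"
      using pendant grown_tree_finite[OF pendant.hyps(1)] by simp
    then show ?thesis using grown_tree.pendant[OF pendant.hyps] by blast
  qed
qed

lemma connected_on_insert:
  assumes "connected_on T E" "y \<in> T" "E x y" "\<And>x y. E x y \<Longrightarrow> E y x"
  shows "connected_on (insert x T) E"
proof -
  let ?r = "\<lambda>a b. a \<in> insert x T \<and> b \<in> insert x T \<and> E a b"
  have T: "?r\<^sup>*\<^sup>* a b" if "a \<in> T" "b \<in> T" for a b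
    using assms(1) that unfolding connected_on_def
    by (auto elim!: rtranclp_mono[THEN predicate2D, rotated])
  have "?r x y" "?r y x" using assms by auto
  then have "?r\<^sup>*\<^sup>* x b" "?r\<^sup>*\<^sup>* b x" if "b \<in> T" for b
    using T[of y b] T[of b y] that assms(2)
    by (auto intro: converse_rtranclp_into_rtranclp rtranclp.rtrancl_into_rtrancl)
  then show ?thesis using T unfolding connected_on_def by auto
qed

text \<open>A walk inside \<open>S\<close> that starts in \<open>X\<close> can never leave
  \<open>X\<close>.\<close>

lemma connected_on_closed_subset:
  assumes "connected_on S E" "x \<in> X" "X \<subseteq> S"
    and closed: "\<And>a b. \<lbrakk>a \<in> X; b \<in> S; E a b\<rbrakk> \<Longrightarrow> b \<in> X"
  shows "X = S"
proof
  show "S \<subseteq> X"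
  proof
    fix y assume "y \<in> S"
    then have "(\<lambda>a b. a \<in> S \<and> b \<in> S \<and> E a b)\<^sup>*\<^sup>* x y"
      using assms(1-3) by (auto simp: connected_on_def)
    then show "y \<in> X" by induction (use assms(2) closed in auto)
  qed
qed fact

text \<open>The two neighbours are the cyclic predecessor and successor of \<open>x\<close> in the
  list; their positions differ because the length is at least 3.\<close>

lemma cycle_two_neighbours:
  assumes "length xs \<ge> 3" "distinct xs" "\<forall>i. Suc i < length xs \<longrightarrow> E (xs ! i) (xs ! Suc i)"
    "E (last xs) (hd xs)" "x \<in> set xs" "\<And>x y. E x y \<Longrightarrow> E y x"
  shows "\<exists>p\<in>set xs. \<exists>q\<in>set xs. p \<noteq> q \<and> p \<noteq> x \<and> q \<noteq> x \<and> E x p \<and> E x q"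
proof -
  obtain i where i: "i < length xs" "xs ! i = x" using assms(5) by (auto simp: in_set_conv_nth)
  let ?n = "length xs"
  define j where "j = (if i = 0 then ?n - 1 else i - 1)"
  define l where "l = (if i = ?n - 1 then 0 else Suc i)"
  have ends: "last xs = xs ! (?n - 1)" "hd xs = xs ! 0"
    using assms(1) by (cases "xs = []"; simp add: last_conv_nth hd_conv_nth)+
  have lt: "j < ?n" "l < ?n" using i assms(1) by (auto simp: j_def l_def)
  have ne: "j \<noteq> l" "j \<noteq> i" "l \<noteq> i" using i assms(1) by (auto simp: j_def l_def split: if_splits)
  have "E (xs ! j) (xs ! i)"
    using assms(3)[rule_format, of j] assms(4) i ends by (auto simp: j_def)
  moreover have "E (xs ! i) (xs ! l)"
    using assms(3)[rule_format, of i] assms(4) i ends by (auto simp: l_def)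
  ultimately show ?thesis
    using lt ne i assms(2,6)
    by (intro bexI[of _ "xs ! j"] bexI[of _ "xs ! l"]) (auto simp: nth_eq_iff_index_eq)
qed

text \<open>A cycle avoiding the newest vertex lies in the earlier tree; a cycle through it would
  give it two neighbours there.\<close>

lemma grown_tree_imp_induced_tree:
  assumes "grown_tree E r T" and sym: "\<And>x y. E x y \<Longrightarrow> E y x"
  shows "induced_tree T E"
  using assms(1)
proof (induction rule: grown_tree.induct)
  case root
  have "\<not> has_cycle_on {r} E"
  proof
    assume "has_cycle_on {r} E"
    then obtain xs where "length xs \<ge> 3" "distinct xs" "set xs \<subseteq> {r}"
      by (auto simp: has_cycle_on_def)
    then show False using card_mono[of "{r}" "set xs"] by (simp add: distinct_card)
  qed
  then show ?case by (auto simp: induced_tree_def connected_on_def)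
next
  case (pendant T x)
  from pendant.hyps(3) obtain y where y: "y \<in> T" "E x y" by blast
  have "\<not> has_cycle_on (insert x T) E"
  proof
    assume "has_cycle_on (insert x T) E"
    then obtain xs where xs: "length xs \<ge> 3" "distinct xs" "set xs \<subseteq> insert x T"
      "\<forall>i. Suc i < length xs \<longrightarrow> E (xs ! i) (xs ! Suc i)" "E (last xs) (hd xs)"
      by (auto simp: has_cycle_on_def)
    show False
    proof (cases "x \<in> set xs")
      case True
      from cycle_two_neighbours[OF xs(1,2,4,5) True sym] pendant.hyps(3) xs(3)
      show False by blast
    next
      case False
      then have "has_cycle_on T E" using xs unfolding has_cycle_on_def by blast
      then show False using pendant.IH by (simp add: induced_tree_def)
    qed
  qed
  then show ?case
    using pendant.IH connected_on_insert[of T E y x] y sym by (auto simp: induced_tree_def)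
qed

text \<open>The growth of \<open>T'\<close> is replayed on top of \<open>T\<close>. Each new vertex
  keeps its unique neighbour, because in \<open>T\<close> it can only be adjacent to
  \<open>w\<close>, which belongs to every stage of \<open>T'\<close>.\<close>

lemma grown_tree_glue:
  assumes "grown_tree E w T'" "grown_tree E v T" "w \<in> T" "T' \<inter> T \<subseteq> {w}"
    "\<And>x y. \<lbrakk>x \<in> T' - {w}; y \<in> T - {w}\<rbrakk> \<Longrightarrow> \<not> E x y"
  shows "grown_tree E v (T \<union> T')"
  using assms(1,4,5)
proof (induction rule: grown_tree.induct)
  case root
  then show ?case using assms(2,3) by (simp add: insert_absorb)
next
  case (pendant T' x)
  have w: "w \<in> T'" using grown_tree_root_mem[OF pendant.hyps(1)] .
  then have x: "x \<noteq> w" using pendant.hyps(2) by blast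
  have "grown_tree E v (T \<union> T')" using pendant by blast
  moreover have "x \<notin> T \<union> T'" using pendant.hyps(2) pendant.prems(1) x by blast
  moreover have "y \<in> T \<union> T' \<and> E x y \<longleftrightarrow> y \<in> T' \<and> E x y" for y
    using pendant.prems(2)[of x y] x w by blast
  then have "\<exists>!y. y \<in> T \<union> T' \<and> E x y" using pendant.hyps(3) by simp
  ultimately have "grown_tree E v (insert x (T \<union> T'))" by (rule grown_tree.pendant)
  then show ?case by simp
qed

text \<open>Since \<open>w\<close> is outside \<open>A\<close>, the last hypothesis makes
  \<open>A\<close> independent, and its members can be attached one after another.\<close>

lemma grown_tree_add_leaves:
  assumes "grown_tree E v T" "w \<in> T" "finite A" "A \<inter> T = {}"
    "\<And>x. x \<in> A \<Longrightarrow> E x w" "\<And>x y. \<lbrakk>x \<in> A; y \<in> T \<union> A; E x y\<rbrakk> \<Longrightarrow> y = w"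
  shows "grown_tree E v (T \<union> A)"
  using assms(3-6)
proof (induction rule: finite_induct)
  case empty
  then show ?case using assms(1) by simp
next
  case (insert x F)
  have "grown_tree E v (T \<union> F)"
  proof (rule insert.IH)
    show "F \<inter> T = {}" using insert.prems(1) by blast
    show "\<And>x. x \<in> F \<Longrightarrow> E x w" using insert.prems(2) by blast
    show "\<And>x y. \<lbrakk>x \<in> F; y \<in> T \<union> F; E x y\<rbrakk> \<Longrightarrow> y = w" using insert.prems(3) by blast
  qed
  moreover have "x \<notin> T \<union> F" using insert by blast
  moreover have "\<exists>!y. y \<in> T \<union> F \<and> E x y"
    using insert.prems(2)[of x] insert.prems(3)[of x] assms(2) by (intro ex1I[of _ w]) blast+
  ultimately have "grown_tree E v (insert x (T \<union> F))" by (rule grown_tree.pendant)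
  then show ?case by simp
qed


section \<open>Connected components\<close>

text \<open>The components are the reachability classes of \<open>R\<close>; symmetry of
  \<open>E\<close> makes reachability an equivalence.\<close>

lemma connected_components:
  fixes R :: "'a set"
  assumes sym: "\<And>x y. E x y \<Longrightarrow> E y x"
  obtains CC where "\<Union>CC = R" "{} \<notin> CC" "pairwise disjnt CC"
    "\<And>C. C \<in> CC \<Longrightarrow> connected_on C E"
    "\<And>C x y. \<lbrakk>C \<in> CC; x \<in> C; y \<in> R; E x y\<rbrakk> \<Longrightarrow> y \<in> C"
proof -
  define r where "r A a b \<longleftrightarrow> a \<in> A \<and> b \<in> A \<and> E a b" for A a b
  define comp where "comp x = {y. (r R)\<^sup>*\<^sup>* x y}" for x
  have symr: "(r A)\<^sup>*\<^sup>* y x" if "(r A)\<^sup>*\<^sup>* x y" for A x y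
    using that
  proof induction
    case (step y z)
    then have "r A z y" using sym by (auto simp: r_def)
    then show ?case using step.IH by (rule converse_rtranclp_into_rtranclp)
  qed simp
  have sub: "comp x \<subseteq> R" if "x \<in> R" for x
  proof
    fix y assume "y \<in> comp x"
    then have "(r R)\<^sup>*\<^sup>* x y" by (simp add: comp_def)
    then show "y \<in> R" using that by induction (auto simp: r_def)
  qed
  have closed: "z \<in> comp x" if "x \<in> R" "y \<in> comp x" "z \<in> R" "E y z" for x y z
  proof -
    have "r R y z" using that sub[of x] by (auto simp: r_def)
    then show ?thesis using that(2) by (auto simp: comp_def)
  qed
  have eq: "comp y = comp x" if "y \<in> comp x" for x y
    using that symr[of R x y] by (auto simp: comp_def intro: rtranclp_trans)
  \<comment> \<open>Every vertex on a path in \<open>R\<close> from \<open>x\<close> is itself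
    reachable from \<open>x\<close>, so the path already runs inside the class.\<close>
  have inside: "(r (comp x))\<^sup>*\<^sup>* x y" if "x \<in> R" "y \<in> comp x" for x y
  proof -
    have "(r R)\<^sup>*\<^sup>* x y" using that(2) by (simp add: comp_def)
    then show ?thesis
    proof induction
      case (step y z)
      then have "y \<in> comp x" "z \<in> comp x"
        by (auto simp: comp_def intro: rtranclp.rtrancl_into_rtrancl)
      then have "r (comp x) y z" using step.hyps by (simp add: r_def)
      then show ?case using step.IH by simp
    qed simp
  qed
  have conn: "connected_on (comp x) E" if "x \<in> R" for x
    unfolding connected_on_def r_def[symmetric, abs_def]
    using inside[OF that] symr rtranclp_trans[of "r (comp x)"] by blast
  show ?thesis
  proof (rule that[of "comp ` R"])
    show "\<Union> (comp ` R) = R" using sub by (auto simp: comp_def)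
    show "{} \<notin> comp ` R" by (auto simp: comp_def)
    show "pairwise disjnt (comp ` R)"
      unfolding pairwise_def disjnt_def using eq by blast
  qed (use conn closed in auto)
qed

section \<open>The extremal graph described by layers\<close>

text \<open>The graph G_k up to isomorphism: l assigns to a vertex the index i of the path vertex v_i
  of which it is a copy.\<close>

definition layered :: "('a \<Rightarrow> 'a \<Rightarrow> bool) \<Rightarrow> 'a set \<Rightarrow> 'a \<Rightarrow> nat \<Rightarrow> ('a \<Rightarrow> nat) \<Rightarrow> bool" where
  "layered E S v k l \<longleftrightarrow> (\<forall>x\<in>S. l x = 0 \<longleftrightarrow> x = v) \<and> (\<forall>x\<in>S. x \<noteq> v \<longrightarrow> l x < k)
    \<and> (\<forall>i. 1 \<le> i \<and> i < k \<longrightarrow> card {x\<in>S. l x = i} = k - i)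
    \<and> (\<forall>x\<in>S. \<forall>y\<in>S. E x y \<longleftrightarrow> l y = l x + 1 \<or> l x = l y + 1)"

text \<open>Each layer is numbered by a bijection onto an initial segment; adjacency on both sides
  depends on layer indices alone, so any numbering works.\<close>

lemma layered_imp_iso:
  assumes "layered E S v k l" "finite S" "v \<in> S"
  shows "\<exists>f. graph_iso S E (Gk_V k) (Gk_E k) f \<and> f v = (0, 0)"
proof -
  note L = assms(1)[unfolded layered_def]
  have "\<exists>g. bij_betw g {x\<in>S. l x = i} {..<k - i}" if "1 \<le> i" "i < k" for i
    using L that assms(2) by (intro finite_same_card_bij) auto
  then obtain g where g: "\<And>i. \<lbrakk>1 \<le> i; i < k\<rbrakk> \<Longrightarrow> bij_betw (g i) {x\<in>S. l x = i} {..<k - i}"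
    by metis
  \<comment> \<open>\<open>g\<close> is specified only for layers 1 to k - 1; the root, alone in
    layer 0, gets second coordinate 0.\<close>
  define f where "f x = (l x, if l x = 0 then 0 else g (l x) x)" for x
  have lt: "l x = 0 \<or> 1 \<le> l x \<and> l x < k" if "x \<in> S" for x
    using L that by (metis One_nat_def Suc_leI neq0_conv)
  have "inj_on f S"
  proof (rule inj_onI)
    fix x y assume xy: "x \<in> S" "y \<in> S" "f x = f y"
    then have eq: "l x = l y" by (simp add: f_def)
    show "x = y"
    proof (cases "l x = 0")
      case True
      then show ?thesis using eq xy L by metis
    next
      case False
      then have "inj_on (g (l x)) {y\<in>S. l y = l x}"
        using g[of "l x"] lt[OF xy(1)] by (simp add: bij_betw_def)
      moreover have "g (l x) x = g (l x) y" using xy(3) eq False by (simp add: f_def)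
      ultimately show ?thesis using xy eq by (auto dest: inj_onD)
    qed
  qed
  moreover have "f ` S = Gk_V k"
  proof
    show "f ` S \<subseteq> Gk_V k"
    proof
      fix p assume "p \<in> f ` S"
      then obtain x where x: "x \<in> S" "p = f x" by blast
      show "p \<in> Gk_V k"
      proof (cases "l x = 0")
        case False
        then have "1 \<le> l x" "l x < k" using lt[OF x(1)] by auto
        moreover from this have "g (l x) x \<in> {..<k - l x}"
          using g[of "l x"] x(1) by (auto simp: bij_betw_def)
        ultimately show ?thesis using x by (auto simp: f_def Gk_V_def)
      qed (simp add: f_def Gk_V_def x)
    qed
    show "Gk_V k \<subseteq> f ` S"
    proof
      fix p assume p: "p \<in> Gk_V k"
      show "p \<in> f ` S"
      proof (cases "p = (0, 0)")
        case True
        then show ?thesis using assms(3) L by (intro image_eqI[of _ _ v]) (auto simp: f_def)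
      next
        case False
        then obtain i j where ij: "p = (i, j)" "1 \<le> i" "i \<le> k - 1" "j < k - i"
          using p by (auto simp: Gk_V_def)
        then have "j \<in> g i ` {x\<in>S. l x = i}" using g[of i] by (auto simp: bij_betw_def)
        then obtain x where "x \<in> S" "l x = i" "g i x = j" by auto
        then show ?thesis using ij by (intro image_eqI[of _ _ x]) (auto simp: f_def)
      qed
    qed
  qed
  ultimately have "bij_betw f S (Gk_V k)" by (simp add: bij_betw_def)
  moreover have "E x y \<longleftrightarrow> Gk_E k (f x) (f y)" if "x \<in> S" "y \<in> S" for x y
  proof -
    have "E x y \<longleftrightarrow> l y = l x + 1 \<or> l x = l y + 1" using L that by blast
    moreover have "f x \<in> Gk_V k" "f y \<in> Gk_V k" using \<open>f ` S = Gk_V k\<close> that by blast+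
    ultimately show ?thesis by (simp add: Gk_E_def f_def)
  qed
  moreover have "f v = (0, 0)" using L assms(3) by (simp add: f_def)
  ultimately show ?thesis unfolding graph_iso_def by blast
qed

section \<open>Trees assembled from a star and trees in components\<close>

text \<open>No vertex set is fixed, so one adjacency serves all vertex subsets met in the induction.
  With all three vertices equal, \<open>no_triangle\<close> also excludes loops.\<close>

locale triangle_free_adjacency =
  fixes E :: "'a \<Rightarrow> 'a \<Rightarrow> bool"
  assumes sym: "E x y \<Longrightarrow> E y x"
    and no_triangle: "\<lbrakk>E x y; E y z\<rbrakk> \<Longrightarrow> \<not> E x z"
begin

lemma irrefl: "\<not> E x x"
  using no_triangle by blast

definition touches :: "'a \<Rightarrow> 'a set \<Rightarrow> bool" where
  "touches w C \<longleftrightarrow> (\<exists>x\<in>C. E w x)"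

text \<open>Two adjacent neighbours of \<open>v\<close> would form a triangle with it, so all of
  \<open>U\<close> can be attached as leaves.\<close>

lemma grown_star:
  assumes "finite U" "\<And>w. w \<in> U \<Longrightarrow> E v w"
  shows "grown_tree E v (insert v U)"
proof -
  have "grown_tree E v ({v} \<union> U)"
  proof (rule grown_tree_add_leaves[OF grown_tree.root, of v])
    show "U \<inter> {v} = {}" using assms(2) irrefl by blast
    show "y = v" if "x \<in> U" "y \<in> {v} \<union> U" "E x y" for x y
      using that assms(2) no_triangle[of v x y] by blast
  qed (use assms sym in auto)
  then show ?thesis by simp
qed

text \<open>Starting from the star on \<open>U\<close>, the tree of each \<open>C\<close> in
  \<open>D\<close> is glued on at the only vertex of \<open>U\<close> touching \<open>C\<close>; no
  other vertex collected so far has a neighbour in \<open>C\<close>. The gluing vertex is already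
  counted, so \<open>C\<close> contributes \<open>a C\<close> and not
  \<open>Suc (a C)\<close>.\<close>

lemma grown_tree_through_components:
  assumes "finite D" "finite U" "\<And>w. w \<in> U \<Longrightarrow> E v w"
    "\<And>C. C \<in> D \<Longrightarrow> \<exists>!w. w \<in> U \<and> touches w C"
    "pairwise disjnt D" "\<And>C. C \<in> D \<Longrightarrow> C \<inter> insert v U = {}"
    "\<And>C x. \<lbrakk>C \<in> D; x \<in> C\<rbrakk> \<Longrightarrow> \<not> E v x"
    "\<And>C C' x y. \<lbrakk>C \<in> D; C' \<in> D; C \<noteq> C'; x \<in> C; y \<in> C'\<rbrakk> \<Longrightarrow> \<not> E x y"
    "\<And>C w. \<lbrakk>C \<in> D; w \<in> U; touches w C\<rbrakk>
      \<Longrightarrow> \<exists>T. grown_tree E w T \<and> T \<subseteq> insert w C \<and> card T = Suc (a C)"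
  shows "\<exists>T. grown_tree E v T \<and> insert v U \<subseteq> T \<and> T \<subseteq> insert v U \<union> \<Union>D
    \<and> card T = Suc (card U + sum a D)"
  using assms(1,4-)
proof (induction D rule: finite_induct)
  case empty
  have "v \<notin> U" using assms(3) irrefl by blast
  then show ?case
    using grown_star[OF assms(2,3)] assms(2) by (intro exI[of _ "insert v U"]) auto
next
  case (insert C F)
  have "\<exists>T. grown_tree E v T \<and> insert v U \<subseteq> T \<and> T \<subseteq> insert v U \<union> \<Union>F
    \<and> card T = Suc (card U + sum a F)"
  proof (rule insert.IH)
    show "pairwise disjnt F" using insert.prems(2) by (simp add: pairwise_insert)
    show "\<exists>!w. w \<in> U \<and> touches w C" if "C \<in> F" for C
      using insert.prems(1)[of C] that by simp
    show "C \<inter> insert v U = {}" if "C \<in> F" for C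
      using insert.prems(3)[of C] that by simp
    show "\<not> E v x" if "C \<in> F" "x \<in> C" for C x
      using insert.prems(4)[of C x] that by simp
    show "\<not> E x y" if "C \<in> F" "C' \<in> F" "C \<noteq> C'" "x \<in> C" "y \<in> C'" for C C' x y
      using insert.prems(5)[of C C' x y] that by simp
    show "\<exists>T. grown_tree E w T \<and> T \<subseteq> insert w C \<and> card T = Suc (a C)"
      if "C \<in> F" "w \<in> U" "touches w C" for C w
      using insert.prems(6)[of C w] that by simp
  qed
  then obtain T where T: "grown_tree E v T" "insert v U \<subseteq> T" "T \<subseteq> insert v U \<union> \<Union>F"
    "card T = Suc (card U + sum a F)" by blast
  obtain w where w: "w \<in> U" "touches w C"
    and uniq: "\<And>u. \<lbrakk>u \<in> U; touches u C\<rbrakk> \<Longrightarrow> u = w"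
    using insert.prems(1)[of C] by blast
  obtain T' where T': "grown_tree E w T'" "T' \<subseteq> insert w C" "card T' = Suc (a C)"
    using insert.prems(6)[of C w] w by blast
  have CF: "C \<inter> \<Union>F = {}"
    using insert.prems(2) insert.hyps(2) by (auto simp: pairwise_insert disjnt_def)
  have int: "T' \<inter> T \<subseteq> {w}"
    using CF T'(2) T(3) insert.prems(3)[of C] by blast
  have wT: "w \<in> T" using T(2) w(1) by blast
  have "grown_tree E v (T \<union> T')"
  proof (rule grown_tree_glue[OF T'(1) T(1) wT int])
    fix x y assume "x \<in> T' - {w}" "y \<in> T - {w}"
    then have x: "x \<in> C" and y: "y \<noteq> w" "y \<in> insert v U \<union> \<Union>F" using T'(2) T(3) by blast+
    show "\<not> E x y"
    proof
      assume xy: "E x y"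
      from y(2) consider "y = v" | "y \<in> U" | C' where "C' \<in> F" "y \<in> C'" by blast
      then show False
      proof cases
        case 1
        then show ?thesis using insert.prems(4)[of C x] x sym[OF xy] by blast
      next
        case 2
        then show ?thesis using uniq[of y] y(1) x sym[OF xy] by (auto simp: touches_def)
      next
        case 3
        then show ?thesis using insert.prems(5)[of C C' x y] insert.hyps(2) x xy by blast
      qed
    qed
  qed
  moreover have "card (T \<union> T') = Suc (card U + sum a (insert C F))"
  proof -
    have fin: "finite T" "finite T'" using T(1) T'(1) by (simp_all add: grown_tree_finite)
    have "T' \<inter> T = {w}" using int wT grown_tree_root_mem[OF T'(1)] by blast
    then show ?thesis
      using card_Un_Int[OF fin] T(4) T'(3) insert.hyps by (simp add: Int_commute)
  qed
  ultimately show ?case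
    using T(2,3) T'(2) w(1) by (intro exI[of _ "T \<union> T'"]) auto
qed

section \<open>The equality case: adding one layer\<close>

text \<open>Two vertices of \<open>N\<close> with different neighbours in \<open>C\<close> would
  yield a tree on k + 1 vertices. Hence \<open>N\<close> can serve as layer 1, while the layers of
  \<open>C\<close> move up by one.\<close>

lemma layered_step:
  assumes fin: "finite S" and v: "v \<in> S"
    and bound: "\<And>T. \<lbrakk>grown_tree E v T; T \<subseteq> S\<rbrakk> \<Longrightarrow> card T \<le> k"
    and N: "N = {w\<in>S. E v w}" and C: "C = S - insert v N"
    and layers: "\<And>w. \<lbrakk>w \<in> N; touches w C\<rbrakk> \<Longrightarrow> \<exists>l. layered E (insert w C) w (k - 1) l"
    and cardN: "card N = k - 1" and w0: "w0 \<in> N" "touches w0 C"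
  shows "\<exists>l. layered E S v k l"
proof -
  define A where "A w = {x\<in>C. E w x}" for w
  have finC: "finite C" and NC: "N \<inter> C = {}" and vC: "v \<notin> C" and vN: "v \<notin> N"
    using fin C N irrefl by auto
  have CvE: "\<not> E v x" "\<not> E x v" if "x \<in> C" for x using that C N sym by blast+
  have NvE: "E v w" "E w v" if "w \<in> N" for w using that N sym by auto
  have NN: "\<not> E x y" if "x \<in> N" "y \<in> N" for x y
    using that NvE no_triangle by blast
  have finA: "finite (A w)" for w using finC by (simp add: A_def)
  \<comment> \<open>\<open>A w\<close> is layer 1 of \<open>insert w C\<close> and \<open>L\<close>
    is its layer 2; their sizes are (k - 1) - 1 and (k - 1) - 2.\<close>
  have k3: "k \<ge> 3" and cardA: "card (A w) = k - 2"
    and L2: "\<exists>L\<subseteq>C. card L = k - 3 \<and> (\<forall>x\<in>A w. \<forall>y\<in>L. E x y) \<and> (\<forall>x\<in>L. \<forall>y\<in>L. \<not> E x y)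
      \<and> (\<forall>y\<in>L. \<not> E w y)"
    if w: "w \<in> N" "touches w C" for w
  proof -
    obtain l where l: "layered E (insert w C) w (k - 1) l" using layers[OF w] by blast
    note L = l[unfolded layered_def]
    have wC: "w \<notin> C" using w NC by blast
    have lw: "l w = 0" using L by simp
    obtain x where "x \<in> C" using w(2) by (auto simp: touches_def)
    then have "l x \<noteq> 0" "l x < k - 1" using L wC by (metis insertI2)+
    then show k3: "k \<ge> 3" by simp
    have A: "A w = {x\<in>insert w C. l x = 1}" using L lw by (auto simp: A_def)
    show "card (A w) = k - 2" unfolding A using L k3 by simp
    define L' where "L' = {x\<in>insert w C. l x = 2}"
    have card: "card L' = k - 3"
    \<comment> \<open>The cardinality clause of \<open>layered\<close> covers only layers below k -
      1, so for k = 3 the emptiness of layer 2 comes from the bound on the labels.\<close>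
    proof (cases "k = 3")
      case True
      then have "L' = {}" using L lw by (fastforce simp: L'_def)
      then show ?thesis using True by simp
    next
      case False
      then show ?thesis using L k3 by (simp add: L'_def)
    qed
    have adj: "E x y \<longleftrightarrow> l y = l x + 1 \<or> l x = l y + 1"
      if "x \<in> insert w C" "y \<in> insert w C" for x y
      using L that by blast
    have "L' \<subseteq> C" using lw by (auto simp: L'_def)
    moreover have "\<forall>x\<in>A w. \<forall>y\<in>L'. E x y" unfolding A L'_def by (auto simp: adj)
    moreover have "\<forall>x\<in>L'. \<forall>y\<in>L'. \<not> E x y" unfolding L'_def by (auto simp: adj)
    moreover have "\<forall>y\<in>L'. \<not> E w y" unfolding L'_def using lw by (auto simp: adj)
    ultimately show "\<exists>L\<subseteq>C. card L = k - 3 \<and> (\<forall>x\<in>A w. \<forall>y\<in>L. E x y)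
      \<and> (\<forall>x\<in>L. \<forall>y\<in>L. \<not> E x y) \<and> (\<forall>y\<in>L. \<not> E w y)"
      using card by (intro exI[of _ L'] conjI)
  qed
  have cherry: "grown_tree E v {v, w, u}" "card {v, w, u} = 3"
    if "w \<in> N" "u \<in> N" "w \<noteq> u" for w u
  proof -
    show "grown_tree E v {v, w, u}" using grown_star[of "{w, u}" v] that NvE by auto
    have "v \<noteq> w" "v \<noteq> u" using that vN by blast+
    then show "card {v, w, u} = 3" using that(3) by simp
  qed
  \<comment> \<open>Otherwise \<open>A w\<close> can be added as leaves at \<open>w\<close> to the
    path u - v - w, giving 3 + (k - 2) = k + 1 vertices.\<close>
  have meet: "A w \<inter> A u \<noteq> {}" if w: "w \<in> N" "touches w C" and u: "u \<in> N" "w \<noteq> u" for w u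
  proof
    assume disj: "A w \<inter> A u = {}"
    have "grown_tree E v ({v, w, u} \<union> A w)"
    proof (rule grown_tree_add_leaves[OF cherry(1)[OF w(1) u], of w])
      show "A w \<inter> {v, w, u} = {}" using NC vC w u by (auto simp: A_def)
      show "E x w" if "x \<in> A w" for x using that sym by (auto simp: A_def)
      show "y = w" if "x \<in> A w" "y \<in> {v, w, u} \<union> A w" "E x y" for x y
        using that CvE disj sym[of x y] no_triangle[of w x y] by (auto simp: A_def)
    qed (use finA in auto)
    moreover have "{v, w, u} \<union> A w \<subseteq> S" using v w(1) u(1) N C by (auto simp: A_def)
    moreover have "card ({v, w, u} \<union> A w) = k + 1"
    proof -
      have "{v, w, u} \<inter> A w = {}" using NC vC w u by (auto simp: A_def)
      then show ?thesis
        using card_Un_disjoint[of "{v, w, u}" "A w"] finA cherry(2)[OF w(1) u] cardA[OF w] k3[OF w]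
        by simp
    qed
    ultimately show False using bound by fastforce
  qed
  have touch: "touches u C" if "u \<in> N" for u
    using meet[OF w0 that] w0 by (cases "w0 = u") (auto simp: A_def touches_def)
  have sub: "A w \<subseteq> A u" if w: "w \<in> N" and u: "u \<in> N" for w u
  proof (rule ccontr)
    assume "\<not> A w \<subseteq> A u"
    then obtain x where x: "x \<in> A w" "x \<notin> A u" by blast
    then have ne: "w \<noteq> u" by blast
    note tw = touch[OF w]
    obtain z where z: "z \<in> A w" "z \<in> A u" using meet[OF w tw u ne] by blast
    obtain L where L: "L \<subseteq> C" "card L = k - 3" "\<forall>x\<in>A w. \<forall>y\<in>L. E x y"
      "\<forall>x\<in>L. \<forall>y\<in>L. \<not> E x y" "\<forall>y\<in>L. \<not> E w y" using L2[OF w tw] by blast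
    \<comment> \<open>The common neighbour \<open>z\<close> is adjacent to \<open>u\<close> and to
      all of \<open>L\<close>, so an edge from \<open>u\<close> to \<open>L\<close> would close a
      triangle.\<close>
    have uL: "\<not> E u y" if "y \<in> L" for y
    proof -
      have "E z y" using L(3) z(1) that by blast
      moreover have "E u z" using z(2) by (simp add: A_def)
      ultimately show ?thesis using no_triangle by blast
    qed
    have finL: "finite L" using L(1) finC finite_subset by blast
    have xC: "x \<in> C" "E w x" "\<not> E u x" using x by (auto simp: A_def)
    have xL: "x \<notin> L" using L(5) xC by blast
    \<comment> \<open>The tree is the path u - v - w - x with \<open>L\<close> as leaves at
      \<open>x\<close>, on 4 + (k - 3) = k + 1 vertices.\<close>
    let ?T = "{v, w, u} \<union> {x}"
    have T: "grown_tree E v ?T"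
      using cherry(1)[OF w u ne]
    proof (rule grown_tree_add_leaves[of _ _ _ w])
      show "{x} \<inter> {v, w, u} = {}" using xC NC vC w u by auto
      show "y' = w" if "x' \<in> {x}" "y' \<in> {v, w, u} \<union> {x}" "E x' y'" for x' y'
        using that CvE xC irrefl sym[of x u] by auto
    qed (use xC sym in auto)
    have "grown_tree E v (?T \<union> L)"
      using T
    proof (rule grown_tree_add_leaves[of _ _ _ x])
      show "L \<inter> ?T = {}" using L(1) xL NC vC w u by auto
      show "E y x" if "y \<in> L" for y using that L(3) x(1) sym by blast
      show "y' = x" if "y \<in> L" "y' \<in> ?T \<union> L" "E y y'" for y y'
        using that CvE[of y] L(1,4,5) uL[of y] sym[of y y'] by blast
    qed (use finL in auto)
    moreover have "?T \<union> L \<subseteq> S" using v w u xC L(1) N C by auto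
    moreover have "card (?T \<union> L) = k + 1"
    proof -
      have "x \<notin> {v, w, u}" using xC NC vC w u by blast
      then have "card ?T = 4"
        using cherry(2)[OF w u ne] card_insert_disjoint[of "{v, w, u}" x] by simp
      moreover have "?T \<inter> L = {}" using L(1) xL NC vC w u by auto
      ultimately show ?thesis
        using card_Un_disjoint[of ?T L] finL L(2) k3[OF w tw] by simp
    qed
    ultimately show False using bound by fastforce
  qed
  have same: "E w x \<longleftrightarrow> E w0 x" if "w \<in> N" "x \<in> C" for w x
    using sub[OF that(1) w0(1)] sub[OF w0(1) that(1)] that(2) by (auto simp: A_def)
  obtain l0 where "layered E (insert w0 C) w0 (k - 1) l0" using layers[OF w0] by blast
  note l0 = this[unfolded layered_def]
  define l where "l x = (if x = v then 0 else if x \<in> N then 1 else Suc (l0 x))" for x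
  have w0C: "w0 \<notin> C" using NC w0 by blast
  have l0w: "l0 w0 = 0" using l0 by simp
  have l0C: "0 < l0 x" "l0 x < k - 1" if "x \<in> C" for x
    using l0 that w0C by (metis insertI2 neq0_conv)+
  have lv: "l v = 0" and lN: "\<And>x. x \<in> N \<Longrightarrow> l x = 1"
    and lC: "\<And>x. x \<in> C \<Longrightarrow> l x = Suc (l0 x)"
    using vN NC vC by (auto simp: l_def)
  have S: "S = insert v (N \<union> C)" using C N v by auto
  have "layered E S v k l"
    unfolding layered_def
  proof (intro conjI ballI allI impI)
    fix x assume x: "x \<in> S"
    show "l x = 0 \<longleftrightarrow> x = v" by (simp add: l_def)
    show "l x < k" if "x \<noteq> v"
      using x that S lN lC l0C[of x] k3[OF w0] by auto
    fix y assume y: "y \<in> S"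
    have NCE: "E a b \<longleftrightarrow> l0 b = 1" "E b a \<longleftrightarrow> l0 b = 1" if "a \<in> N" "b \<in> C" for a b
    proof -
      have "E w0 b \<longleftrightarrow> l0 b = 1" using l0 l0w that(2) l0C[of b] by simp
      then show "E a b \<longleftrightarrow> l0 b = 1" using same[OF that] by simp
      then show "E b a \<longleftrightarrow> l0 b = 1" using sym by blast
    qed
    have CCE: "E a b \<longleftrightarrow> l0 b = l0 a + 1 \<or> l0 a = l0 b + 1" if "a \<in> C" "b \<in> C" for a b
      using l0 that by simp
    consider "x = v" | "x \<in> N" | "x \<in> C" using x S by blast
    then show "E x y \<longleftrightarrow> l y = l x + 1 \<or> l x = l y + 1"
    proof cases
      case 1
      then show ?thesis using y S lv lN lC CvE NvE irrefl l0C(1) by fastforce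
    next
      case 2
      then show ?thesis using y S lv lN lC NvE NN NCE l0C(1) by fastforce
    next
      case 3
      then show ?thesis using y S lv lN lC CvE NCE CCE l0C(1) by fastforce
    qed
  next
    fix i :: nat assume i: "1 \<le> i \<and> i < k"
    show "card {x\<in>S. l x = i} = k - i"
    proof (cases "i = 1")
      case True
      then have "{x\<in>S. l x = i} = N" using S lv lN lC l0C by fastforce
      then show ?thesis using cardN True by simp
    next
      case False
      then obtain j where j: "i = Suc j" "1 \<le> j" using i by (cases i) auto
      \<comment> \<open>Layer i is the old layer j = i - 1, which excludes \<open>w0\<close> as j is
        positive, and (k - 1) - j = k - i.\<close>
      have "{x\<in>S. l x = i} = {x\<in>insert w0 C. l0 x = j}"
        using S lv lN lC l0w j by fastforce
      then show ?thesis using l0 i j by auto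
    qed
  qed
  then show ?thesis by blast
qed

section \<open>Induction on the number of vertices\<close>

text \<open>The inequality is n \<le> 1 + (k - 1)k/2 for n = \<open>card S\<close>, doubled and
  rearranged to avoid division and truncated subtraction. \<open>S\<close>, \<open>v\<close> and
  \<open>k\<close> all vary, as the induction hypothesis is applied to a component together with one
  neighbour of the root.\<close>

lemma extremal_bound:
  assumes "finite S" "connected_on S E" "v \<in> S"
    "\<And>T. \<lbrakk>grown_tree E v T; T \<subseteq> S\<rbrakk> \<Longrightarrow> card T \<le> k"
  shows "2 * card S + k \<le> 2 + k * k
    \<and> (2 * card S + k = 2 + k * k \<longrightarrow> (\<exists>l. layered E S v k l))"
  using assms
proof (induction "card S" arbitrary: S v k rule: less_induct)
  case less
  note fin = less.prems(1) and conn = less.prems(2) and v = less.prems(3)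
    and bound = less.prems(4)
  define N where "N = {w\<in>S. E v w}"
  define R where "R = S - insert v N"
  have finN: "finite N" and finR: "finite R" using fin by (auto simp: N_def R_def)
  have vN: "v \<notin> N" using irrefl by (simp add: N_def)
  have Nv: "E v w" if "w \<in> N" for w using that by (simp add: N_def)
  have Rv: "\<not> E v x" if "x \<in> R" for x using that by (auto simp: N_def R_def)
  have S: "S = insert v (N \<union> R)" using v by (auto simp: N_def R_def)
  have "insert v N \<subseteq> S" using v by (auto simp: N_def)
  from bound[OF grown_star[OF finN Nv] this] have "card N + 1 \<le> k" using finN vN by simp
  then obtain m where k: "k = Suc m" and cardN: "card N \<le> m" by (cases k) auto
  obtain CC where CC: "\<Union>CC = R" "{} \<notin> CC" "pairwise disjnt CC"
    and CCconn: "\<And>C. C \<in> CC \<Longrightarrow> connected_on C E"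
    and CCclosed: "\<And>C x y. \<lbrakk>C \<in> CC; x \<in> C; y \<in> R; E x y\<rbrakk> \<Longrightarrow> y \<in> C"
    using connected_components[of E R] sym by blast
  have subR: "C \<subseteq> R" if "C \<in> CC" for C using CC(1) that by blast
  have finCC: "finite CC" using CC(1) finR by (auto intro: finite_UnionD)
  have finC: "finite C" if "C \<in> CC" for C using subR[OF that] finR finite_subset by blast
  \<comment> \<open>An untouched component would be closed under adjacency in \<open>S\<close>,
    hence all of \<open>S\<close>, although it misses \<open>v\<close>.\<close>
  have touched: "\<exists>w\<in>N. touches w C" if C: "C \<in> CC" for C
  proof (rule ccontr)
    assume not: "\<not> (\<exists>w\<in>N. touches w C)"
    obtain x where x: "x \<in> C" using CC(2) C by (metis all_not_in_conv)
    have "C = S"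
      using conn x
    proof (rule connected_on_closed_subset)
      show "C \<subseteq> S" using subR[OF C] S by blast
      fix a b assume ab: "a \<in> C" "b \<in> S" "E a b"
      have "b \<noteq> v" using ab sym[of a b] Rv subR[OF C] by blast
      moreover have "b \<notin> N" using not ab sym[of a b] by (auto simp: touches_def)
      ultimately have "b \<in> R" using ab(2) S by blast
      then show "b \<in> C" using CCclosed C ab by blast
    qed
    then show False using v subR[OF C] by (auto simp: R_def)
  qed
  have sub_w: "insert w C \<subseteq> S" "v \<notin> insert w C" "w \<notin> C" if "w \<in> N" "C \<subseteq> R" for w C
    using that vN by (auto simp: R_def N_def)
  have conn_w: "connected_on (insert w C) E" if "connected_on C E" "touches w C" for w C
    using that connected_on_insert[of C E _ w] sym by (auto simp: touches_def)
  have less_w: "card (insert w C) < card S" if "w \<in> N" "C \<subseteq> R" for w C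
    using sub_w[OF that] v fin by (intro psubset_card_mono) auto
  have "\<exists>a. a > 0 \<and> 2 * card C \<le> a * (a + 1) \<and> (\<forall>w\<in>N. touches w C \<longrightarrow>
      (\<exists>T. grown_tree E w T \<and> T \<subseteq> insert w C \<and> card T = Suc a))" if C: "C \<in> CC" for C
  proof -
    \<comment> \<open>If some touching \<open>w\<close> had no tree on a + 1 vertices, truncation
      would bound all its trees by a, and the induction hypothesis with k = a would give 2|C| \<le>
      a(a - 1), against minimality. The choice of \<open>a\<close> depends on \<open>C\<close> only,
      not on \<open>w\<close>.\<close>
    define a where "a = (LEAST a. 2 * card C \<le> a * (a + 1))"
    have "2 * card C \<le> 2 * card C * (2 * card C + 1)" by simp
    then have a: "2 * card C \<le> a * (a + 1)"
      unfolding a_def by (rule LeastI)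
    have "C \<noteq> {}" using C CC(2) by metis
    then have "card C > 0" using finC[OF C] by (simp add: card_gt_0_iff)
    then have a0: "a > 0" using a by (cases a) auto
    then obtain b where b: "a = Suc b" using gr0_implies_Suc by blast
    have min: "\<not> 2 * card C \<le> b * (b + 1)"
      using not_less_Least[of b "\<lambda>a. 2 * card C \<le> a * (a + 1)"] b unfolding a_def by simp
    have "\<exists>T. grown_tree E w T \<and> T \<subseteq> insert w C \<and> card T = Suc a"
      if w: "w \<in> N" "touches w C" for w
    proof (rule ccontr)
      assume none: "\<not> ?thesis"
      have "card T \<le> a" if T: "grown_tree E w T" "T \<subseteq> insert w C" for T
      proof (rule ccontr)
        assume "\<not> card T \<le> a"
        then obtain T' where "grown_tree E w T'" "T' \<subseteq> T" "card T' = Suc a"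
          using grown_tree_truncate[OF T(1), of "Suc a"] by auto
        then show False using none T(2) by blast
      qed
      then have "2 * card (insert w C) + a \<le> 2 + a * a"
        using less.hyps[OF less_w[OF w(1) subR[OF C]] _ conn_w[OF CCconn[OF C] w(2)], of w a]
          finC[OF C] by simp
      then show False using min b sub_w(3)[OF w(1) subR[OF C]] finC[OF C] by simp
    qed
    then show ?thesis using a a0 by blast
  qed
  then obtain a where a: "\<And>C. C \<in> CC \<Longrightarrow> a C > 0"
    "\<And>C. C \<in> CC \<Longrightarrow> 2 * card C \<le> a C * (a C + 1)"
    "\<And>C w. \<lbrakk>C \<in> CC; w \<in> N; touches w C\<rbrakk>
      \<Longrightarrow> \<exists>T. grown_tree E w T \<and> T \<subseteq> insert w C \<and> card T = Suc (a C)"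
    by metis
  show ?case
  proof (cases "N = {}")
    case True
    have "{v} = S"
      using conn
    proof (rule connected_on_closed_subset[of _ _ v])
      show "b \<in> {v}" if "a \<in> {v}" "b \<in> S" "E a b" for a b
        using that True by (auto simp: N_def)
    qed (use v in auto)
    then have S: "S = {v}" by simp
    have "layered E S v k (\<lambda>_. 0)" if "k = 1"
      using that irrefl by (auto simp: layered_def S)
    moreover have "k = 1" if "k = k * k" using that k by simp
    ultimately show ?thesis using S k by auto
  next
    case False
    define n where "n = (\<Sum>C\<in>CC. a C * (a C + 1))"
    obtain U M where U: "U \<subseteq> N" and M: "M = card U + sum a (uniquely_hit touches CC U)"
      and nM: "n + M \<le> M * M"
      and strict: "\<lbrakk>\<exists>C\<in>CC. \<exists>D\<in>CC. C \<noteq> D \<and> a C > 0 \<and> a D > 0\<rbrakk> \<Longrightarrow> n + M < M * M"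
      using heavy_uniquely_hit[of CC N a touches] finCC finN False touched
      unfolding n_def by blast
    define D where "D = uniquely_hit touches CC U"
    have D: "D \<subseteq> CC" by (auto simp: D_def uniquely_hit_def)
    have "\<exists>T. grown_tree E v T \<and> insert v U \<subseteq> T \<and> T \<subseteq> insert v U \<union> \<Union>D
      \<and> card T = Suc (card U + sum a D)"
    proof (rule grown_tree_through_components)
      show "finite D" using D finCC finite_subset by blast
      show "finite U" using U finN finite_subset by blast
      show "E v w" if "w \<in> U" for w using that U Nv by blast
      show "\<exists>!w. w \<in> U \<and> touches w C" if "C \<in> D" for C
        using that by (simp add: D_def uniquely_hit_def)
      show "pairwise disjnt D" using CC(3) D by (rule pairwise_subset)
      show "C \<inter> insert v U = {}" if "C \<in> D" for C
        using that D subR[of C] U by (auto simp: R_def)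
      show "\<not> E v x" if "C \<in> D" "x \<in> C" for C x using that D subR[of C] Rv by blast
      show "\<not> E x y" if "C \<in> D" "C' \<in> D" "C \<noteq> C'" "x \<in> C" "y \<in> C'" for C C' x y
      proof
        assume "E x y"
        moreover have "y \<in> R" using that D subR[of C'] by blast
        ultimately have "y \<in> C" using CCclosed[of C x y] that D by blast
        then show False using that CC(3) D by (auto simp: pairwise_def disjnt_iff)
      qed
      show "\<exists>T. grown_tree E w T \<and> T \<subseteq> insert w C \<and> card T = Suc (a C)"
        if "C \<in> D" "w \<in> U" "touches w C" for C w
        using a(3)[of C w] that D U by blast
    qed
    then obtain T where T: "grown_tree E v T" "T \<subseteq> insert v U \<union> \<Union>D" "card T = Suc M"
      unfolding M D_def by blast
    have "T \<subseteq> S" using T(2) U D CC(1) S by blast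
    \<comment> \<open>The tree has M + 1 vertices and k = m + 1; monotonicity then carries the bound
      on \<open>n\<close> from \<open>M\<close> over to \<open>m\<close>.\<close>
    then have Mm: "M \<le> m" using bound[OF T(1)] T(3) k by simp
    have nm: "n + m \<le> m * m" using quadratic_le_mono[OF Mm nM] .
    have cardR: "card R = sum card CC"
      using card_Union_disjoint[of CC] CC(1,3) finC by simp
    have "2 * card R \<le> n"
      unfolding cardR n_def sum_distrib_left by (rule sum_mono) (use a(2) in blast)
    have "N \<inter> R = {}" "v \<notin> N \<union> R" using vN by (auto simp: R_def)
    then have cardS: "card S = Suc (card N + card R)"
      unfolding S using finN finR by (simp add: card_Un_disjoint)
    have le: "2 * card S + k \<le> 2 + k * k"
      using cardS k cardN nm \<open>2 * card R \<le> n\<close> by simp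
    have "\<exists>l. layered E S v k l" if eq: "2 * card S + k = 2 + k * k"
    proof -
      \<comment> \<open>Equality makes every estimate tight: |N| = m and 2|R| = n = m(m -
        1).\<close>
      have cN: "card N = m" and cR: "2 * card R + m = m * m" and nm: "n + m = m * m"
        using eq cardS k cardN nm \<open>2 * card R \<le> n\<close> by simp_all
      have one: "C = C'" if "C \<in> CC" "C' \<in> CC" for C C'
      proof (rule ccontr)
        assume "C \<noteq> C'"
        then have "n + M < M * M" using strict that a(1) by blast
        then show False using quadratic_less_mono[OF Mm] nm by fastforce
      qed
      show ?thesis
      proof (cases "CC = {}")
        case True
        then have R: "R = {}" using CC(1) by blast
        have "m > 0" using cN False finN by (metis card_gt_0_iff)
        \<comment> \<open>With \<open>R\<close> empty, \<open>cR\<close> reads m = m * m, and m is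
          positive; the graph is a single edge.\<close>
        then have m: "m = 1" using cR R by simp
        then obtain w where w: "N = {w}" using cN by (metis card_1_singletonE)
        have "S = {v, w}" "w \<noteq> v" "E v w" "E w v" using S R w vN Nv sym by auto
        moreover have "{x. x = w} = {w}" by blast
        ultimately have "layered E S v k (\<lambda>x. if x = v then 0 else 1)"
          using k m irrefl unfolding layered_def
          by (auto simp: less_Suc_eq conj_disj_distribR Collect_disj_eq cong: conj_cong)
        then show ?thesis by blast
      next
        case nonempty: False
        then obtain C where C: "C \<in> CC" by blast
        then have "CC = {C}" using one by blast
        then have CR: "C = R" using CC(1) by simp
        obtain w0 where w0: "w0 \<in> N" "touches w0 R" using touched[OF C] CR by blast
        have layers: "\<exists>l. layered E (insert w R) w (k - 1) l" if w: "w \<in> N" "touches w R" for w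
        proof -
          \<comment> \<open>Such a tree can be extended by \<open>v\<close>, whose only neighbour in
            it is \<open>w\<close>, so it has at most k - 1 = m vertices. With \<open>cR\<close>,
            the graph on \<open>insert w R\<close> is then extremal for \<open>m\<close>.\<close>
          have "card T \<le> m" if T: "grown_tree E w T" "T \<subseteq> insert w R" for T
          proof -
            have "T \<inter> insert v {w} = {w}"
              using T(2) grown_tree_root_mem[OF T(1)] sub_w[OF w(1), of R] by auto
            moreover have "grown_tree E v (insert v {w} \<union> T)"
            proof (rule grown_tree_glue[OF T(1) grown_star])
              show "T \<inter> insert v {w} \<subseteq> {w}" using calculation by simp
              show "\<not> E x y" if "x \<in> T - {w}" "y \<in> insert v {w} - {w}" for x y
                using that T(2) Rv sym[of x v] by blast
            qed (use w Nv in auto)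
            moreover have "insert v {w} \<union> T \<subseteq> S" using T(2) S w by blast
            ultimately have "card (insert v {w} \<union> T) \<le> k" "T \<inter> insert v {w} = {w}"
              using bound by blast+
            moreover have "v \<noteq> w" using w vN by blast
            ultimately show ?thesis
              using card_Un_Int[of "insert v {w}" T] grown_tree_finite[OF T(1)] k
              by (simp add: Int_commute)
          qed
          then have "2 * card (insert w R) + m = 2 + m * m \<longrightarrow> (\<exists>l. layered E (insert w R) w m l)"
            using less.hyps[OF less_w[OF w(1)] _ conn_w[OF CCconn w(2)], of w m] finR C CR
            by simp
          then show ?thesis using cR k finR sub_w(3)[OF w(1), of R] by simp
        qed
        show ?thesis
          by (rule layered_step[OF fin v bound N_def R_def layers _ w0]) (use cN k in auto)
      qed
    qed
    with le show ?thesis by blast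
  qed
qed

end

section \<open>From grown trees to induced trees, and from layers to the extremal graph\<close>

theorem theorem1:
  fixes V :: "'a set" and E :: "'a \<Rightarrow> 'a \<Rightarrow> bool" and v :: 'a and k :: nat
  assumes "k \<ge> 1"
    and "simple_graph V E"
    and "connected_on V E"
    and "triangle_free V E"
    and "v \<in> V"
    and "\<not> (\<exists>S. S \<subseteq> V \<and> card S = k + 1 \<and> v \<in> S \<and> induced_tree S E)"
  shows "card V \<le> 1 + (k - 1) * k div 2
    \<and> (card V = 1 + (k - 1) * k div 2 \<longrightarrow>
         (\<exists>f. graph_iso V E (Gk_V k) (Gk_E k) f \<and> f v = (0, 0)))"
proof -
  have fin: "finite V" and sym: "\<And>x y. E x y \<Longrightarrow> E y x"
    using assms(2) by (auto simp: simple_graph_def)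
  interpret triangle_free_adjacency E
  proof
    show "\<not> E x z" if "E x y" "E y z" for x y z
    proof
      assume "E x z"
      moreover have "x \<in> V" "y \<in> V" "z \<in> V"
        using assms(2) that by (simp_all add: simple_graph_def)
      ultimately have "\<exists>x\<in>V. \<exists>y\<in>V. \<exists>z\<in>V. E x y \<and> E y z \<and> E x z"
        using that by (intro bexI conjI)
      then show False using assms(4) by (simp add: triangle_free_def)
    qed
  qed (rule sym)
  have "card T \<le> k" if T: "grown_tree E v T" "T \<subseteq> V" for T
  proof (rule ccontr)
    assume "\<not> card T \<le> k"
    \<comment> \<open>The hypothesis excludes only trees on exactly k + 1 vertices, so a larger tree
      is cut down to that size.\<close>
    then obtain T' where T': "grown_tree E v T'" "T' \<subseteq> T" "card T' = k + 1"
      using grown_tree_truncate[OF T(1), of "k + 1"] by auto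
    then have "induced_tree T' E" "v \<in> T'"
      using grown_tree_imp_induced_tree[of E v T'] sym grown_tree_root_mem by auto
    then show False using assms(6) T' T(2) by blast
  qed
  then have bound: "2 * card V + k \<le> 2 + k * k"
    and layered: "2 * card V + k = 2 + k * k \<Longrightarrow> \<exists>l. layered E V v k l"
    using extremal_bound[OF fin assms(3,5), of k] by auto
  obtain m where k: "k = Suc m" using assms(1) by (cases k) auto
  \<comment> \<open>Evenness makes the integer division in the bound exact.\<close>
  have "even (m * Suc m)" by simp
  then have half: "2 * ((k - 1) * k div 2) = m * Suc m" using k by simp
  have "card V \<le> 1 + (k - 1) * k div 2" using bound half k by simp
  moreover have "2 * card V + k = 2 + k * k" if "card V = 1 + (k - 1) * k div 2"
    using that half k by simp
  ultimately show ?thesis using layered layered_imp_iso[OF _ fin assms(5)] by blast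
qed

end
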